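(* Let $G$ be a simple graph with vertex set $V(G)=\{v_1,\dots,v_n\}$ and edge set $E(G)=\{e_1,\dots,e_m\}$, and let $A$ be its adjacency matrix. Let $\sigma_1(G;x)=\det(xI_n-A)$ and $\sigma_4(G;x)=\mathrm{per}(xI_n-A)$. Then $$(m-n)\sigma_1(G;x)+x\sigma_1'(G;x)=\sum_{v_sv_t\in E(G)}\left[\sigma_1(G-v_sv_t;x)+\sigma_1(G-v_s-v_t;x)\right]$$ and $$(m-n)\sigma_4(G;x)+x\sigma_4'(G;x)=\sum_{v_sv_t\in E(G)}\left[\sigma_4(G-v_sv_t;x)-\sigma_4(G-v_s-v_t;x)\right].$$
   Context: Graphs are finite and simple. $\mathrm{per}(X)=\sum_{\alpha\in S_n}\prod_{k=1}^n x_{k\alpha(k)}$ is the permanent of an $n\times n$ matrix $X=(x_{ij})$. For any graph, $\sigma_1$ and $\sigma_4$ are defined by the same formulas using that graph's own adjacency matrix, and both equal $1$ for the graph with no vertices. $G-v_sv_t$ is $G$ with the edge $v_sv_t$ deleted (keeping all vertices), and $G-v_s-v_t$ is $G$ with the vertices $v_s,v_t$ and all incident edges deleted. The prime denotes the derivative with respect to $x$. Sums over $E(G)$ have one term per (undirected) edge. *)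

theory Defs
  imports "Jordan_Normal_Form.Char_Poly"
begin

record 'a ugraph =
  verts :: "'a set"
  edges :: "'a set set"

definition simple_graph :: "'a ugraph \<Rightarrow> bool" where
  "simple_graph G \<longleftrightarrow> finite (verts G) \<and> (\<forall>e \<in> edges G. e \<subseteq> verts G \<and> card e = 2)"

definition delete_edge :: "'a ugraph \<Rightarrow> 'a set \<Rightarrow> 'a ugraph" where
  "delete_edge G e = \<lparr>verts = verts G, edges = edges G - {e}\<rparr>"

definition delete_verts :: "'a ugraph \<Rightarrow> 'a set \<Rightarrow> 'a ugraph" where
  "delete_verts G U = \<lparr>verts = verts G - U, edges = {e \<in> edges G. e \<inter> U = {}}\<rparr>"

definition adj_matrix_of :: "'a set set \<Rightarrow> 'a list \<Rightarrow> real mat" where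
  "adj_matrix_of E vs =
     mat (length vs) (length vs) (\<lambda>(i, j). if {vs ! i, vs ! j} \<in> E then 1 else 0)"

text \<open>The enumeration is an arbitrary one; the lemmas \<open>sigma1_enum\<close> and \<open>sigma4_enum\<close> below
  show that it does not affect the two polynomials.\<close>

definition vertex_list :: "'a ugraph \<Rightarrow> 'a list" where
  "vertex_list G = (SOME vs. distinct vs \<and> set vs = verts G)"

definition adj_matrix :: "'a ugraph \<Rightarrow> real mat" where
  "adj_matrix G = adj_matrix_of (edges G) (vertex_list G)"

definition per :: "'a :: comm_semiring_1 mat \<Rightarrow> 'a" where
  "per X = (\<Sum>\<alpha> \<in> {\<alpha>. \<alpha> permutes {0..<dim_row X}}. \<Prod>k = 0..<dim_row X. X $$ (k, \<alpha> k))"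

text \<open>\<^const>\<open>char_poly_matrix\<close> \<open>A\<close> is the polynomial matrix \<open>x I - A\<close>.\<close>

definition sigma1 :: "'a ugraph \<Rightarrow> real poly" where
  "sigma1 G = det (char_poly_matrix (adj_matrix G))"

definition sigma4 :: "'a ugraph \<Rightarrow> real poly" where
  "sigma4 G = per (char_poly_matrix (adj_matrix G))"

lemma vertex_list:
  assumes "finite (verts G)"
  shows "distinct (vertex_list G)" "set (vertex_list G) = verts G"
proof -
  have "\<exists>vs. distinct vs \<and> set vs = verts G"
    using finite_distinct_list[OF assms] by blast
  then have "distinct (vertex_list G) \<and> set (vertex_list G) = verts G"
    unfolding vertex_list_def by (rule someI_ex)
  then show "distinct (vertex_list G)" "set (vertex_list G) = verts G"
    by auto
qed

lemma reenumerate: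
  assumes "distinct vs" "distinct ws" "set vs = set ws"
  obtains p where "p permutes {0..<length ws}"
    and "char_poly_matrix (adj_matrix_of E vs) =
      mat (length ws) (length ws) (\<lambda>(i, j). char_poly_matrix (adj_matrix_of E ws) $$ (p i, p j))"
proof -
  have "mset vs = mset ws"
    using assms by (simp add: set_eq_iff_mset_eq_distinct)
  then obtain p where p: "p permutes {..<length ws}" "permute_list p ws = vs"
    by (rule mset_eq_permutation)
  have len: "length vs = length ws"
    using p(2) by auto
  have lt: "p i < length ws" if "i < length ws" for i
    using p(1) that permutes_in_image by fastforce
  have inj: "p i = p j \<longleftrightarrow> i = j" for i j
    using permutes_inj[OF p(1)] by (auto simp: inj_eq)
  have nth: "vs ! i = ws ! p i" if "i < length ws" for i
    using permute_list_nth[OF p(1) that] p(2) by simp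
  show thesis
  proof
    show "p permutes {0..<length ws}"
      using p(1) by (simp add: lessThan_atLeast0)
    show "char_poly_matrix (adj_matrix_of E vs) =
      mat (length ws) (length ws) (\<lambda>(i, j). char_poly_matrix (adj_matrix_of E ws) $$ (p i, p j))"
      by (rule eq_matI) (auto simp: char_poly_matrix_def adj_matrix_of_def len lt inj nth)
  qed
qed

lemma det_permute_both:
  fixes A :: "'a :: comm_ring_1 mat"
  assumes A: "A \<in> carrier_mat n n" and p: "p permutes {0..<n}"
  shows "det (mat n n (\<lambda>(i, j). A $$ (p i, p j))) = det A"
proof -
  have lt: "p i < n" if "i < n" for i
    using p that permutes_in_image by fastforce
  define B where "B = mat n n (\<lambda>(i, j). A $$ (p i, j))"
  have B: "B \<in> carrier_mat n n"
    by (simp add: B_def)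
  have "mat n n (\<lambda>(i, j). A $$ (p i, p j)) =
      transpose_mat (mat n n (\<lambda>(i, j). transpose_mat B $$ (p i, j)))"
    by (rule eq_matI) (auto simp: B_def lt)
  then have "det (mat n n (\<lambda>(i, j). A $$ (p i, p j))) =
      det (mat n n (\<lambda>(i, j). transpose_mat B $$ (p i, j)))"
    using det_transpose[of "mat n n (\<lambda>(i, j). transpose_mat B $$ (p i, j))" n] by simp
  also have "\<dots> = signof p * det (transpose_mat B)"
    using B by (intro det_permute_rows p) simp
  also have "det (transpose_mat B) = signof p * det A"
    using det_transpose[OF B] det_permute_rows[OF A p] by (simp add: B_def)
  also have "signof p * (signof p * det A) = det A"
    by (simp add: sign_def)
  finally show ?thesis .
qed

lemma per_permute_both:
  fixes A :: "'a :: comm_semiring_1 mat"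
  assumes A: "A \<in> carrier_mat n n" and p: "p permutes {0..<n}"
  shows "per (mat n n (\<lambda>(i, j). A $$ (p i, p j))) = per A"
proof -
  let ?S = "{q. q permutes {0..<n}}"
  have lt: "q i < n" if "q permutes {0..<n}" "i < n" for q i
    using that permutes_in_image by fastforce
  have "per (mat n n (\<lambda>(i, j). A $$ (p i, p j))) =
      (\<Sum>q \<in> ?S. \<Prod>k = 0..<n. A $$ (p k, p (q k)))"
    by (auto simp: per_def lt intro!: sum.cong prod.cong)
  also have "\<dots> = (\<Sum>q \<in> ?S. \<Prod>k = 0..<n. A $$ (k, (p \<circ> q \<circ> inv_into UNIV p) k))"
  proof (rule sum.cong[OF refl])
    fix q assume "q \<in> ?S"
    show "(\<Prod>k = 0..<n. A $$ (p k, p (q k))) = (\<Prod>k = 0..<n. A $$ (k, (p \<circ> q \<circ> inv_into UNIV p) k))"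
      using prod.permute[OF p, of "\<lambda>k. A $$ (k, (p \<circ> q \<circ> inv_into UNIV p) k)"]
      by (simp add: permutes_inverses[OF p] comp_def)
  qed
  also have "\<dots> = (\<Sum>q \<in> ?S. \<Prod>k = 0..<n. A $$ (k, q k))"
    by (rule sum.reindex_bij_witness[where i = "\<lambda>q. inv_into UNIV p \<circ> q \<circ> p" and j = "\<lambda>q. p \<circ> q \<circ> inv_into UNIV p"])
      (auto simp: fun_eq_iff permutes_inverses[OF p] intro!: permutes_compose p permutes_inv)
  also have "\<dots> = per A"
    using A by (simp add: per_def)
  finally show ?thesis .
qed

lemma adj_matrix_of_carrier: "adj_matrix_of E vs \<in> carrier_mat (length vs) (length vs)"
  by (simp add: adj_matrix_of_def)

lemma sigma1_enum:
  assumes "distinct vs" "set vs = verts G"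
  shows "sigma1 G = det (char_poly_matrix (adj_matrix_of (edges G) vs))"
proof -
  have "finite (verts G)"
    using assms(2) by (metis List.finite_set)
  note L = vertex_list[OF this]
  obtain p where "p permutes {0..<length vs}"
    and "char_poly_matrix (adj_matrix_of (edges G) (vertex_list G)) = mat (length vs) (length vs)
      (\<lambda>(i, j). char_poly_matrix (adj_matrix_of (edges G) vs) $$ (p i, p j))"
    using reenumerate[of "vertex_list G" vs "edges G"] L assms by auto
  then show ?thesis
    by (simp add: sigma1_def adj_matrix_def det_permute_both adj_matrix_of_carrier)
qed

lemma sigma4_enum:
  assumes "distinct vs" "set vs = verts G"
  shows "sigma4 G = per (char_poly_matrix (adj_matrix_of (edges G) vs))"
proof -
  have "finite (verts G)"
    using assms(2) by (metis List.finite_set)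
  note L = vertex_list[OF this]
  obtain p where "p permutes {0..<length vs}"
    and "char_poly_matrix (adj_matrix_of (edges G) (vertex_list G)) = mat (length vs) (length vs)
      (\<lambda>(i, j). char_poly_matrix (adj_matrix_of (edges G) vs) $$ (p i, p j))"
    using reenumerate[of "vertex_list G" vs "edges G"] L assms by auto
  then show ?thesis
    by (simp add: sigma4_def adj_matrix_def per_permute_both adj_matrix_of_carrier)
qed

lemma sigma_no_vertices:
  assumes "verts G = {}"
  shows "sigma1 G = 1" "sigma4 G = 1"
  using sigma1_enum[of "[]" G] sigma4_enum[of "[]" G] assms
  by (simp_all add: det_def per_def char_poly_matrix_def adj_matrix_of_def)

end

theory Submission
  imports Defs
begin

text \<open>Expand both polynomials over the permutations \<open>\<pi>\<close> of the vertex set. The contribution of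
  \<open>\<pi>\<close> is, up to sign, \<open>x ^ f\<close> with \<open>f\<close> the number of fixed points, provided every moved vertex
  \<open>v\<close> is adjacent to \<open>\<pi> v\<close>; so the left-hand side multiplies it by \<open>m - (n - f)\<close>. The \<open>n - f\<close>
  moved vertices are counted by the edges \<open>{v, \<pi> v}\<close>, an edge being hit twice exactly when
  \<open>\<pi>\<close> exchanges its ends. Hence \<open>m - (n - f)\<close> is the number of edges not of the form
  \<open>{v, \<pi> v}\<close> (deleting such an edge keeps the contribution of \<open>\<pi>\<close>) minus the number of edges
  whose ends are exchanged (composing with the transposition gives a permutation of the
  remaining vertices, which flips the sign of \<open>\<pi>\<close> and so accounts for the different
  signs in the two identities).\<close>

section \<open>Contributions of permutations, indexed by vertices\<close>

definition char_entry :: "'a set set \<Rightarrow> 'a \<Rightarrow> 'a \<Rightarrow> real poly" where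
  "char_entry E v w = (if v = w then [:0, 1:] else if {v, w} \<in> E then - 1 else 0)"

definition perm_term :: "'a set \<Rightarrow> 'a set set \<Rightarrow> ('a \<Rightarrow> 'a) \<Rightarrow> real poly" where
  "perm_term V E \<pi> = (\<Prod>v\<in>V. char_entry E v (\<pi> v))"

text \<open>The determinant arises when \<open>w\<close> is the sign and the permanent when
  \<open>w\<close> is constantly 1; a general weight treats both at once. Indexing by vertices
  instead of matrix positions makes vertex deletion a mere restriction of the sets.\<close>

definition immanant_sum :: "(('a \<Rightarrow> 'a) \<Rightarrow> real) \<Rightarrow> 'a ugraph \<Rightarrow> real poly" where
  "immanant_sum w G =
     (\<Sum>\<pi> | \<pi> permutes verts G. Polynomial.smult (w \<pi>) (perm_term (verts G) (edges G) \<pi>))"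

text \<open>For a two-element \<open>e\<close>, the set \<open>e - {v}\<close> contains just the
  other end. This avoids choosing names for the ends.\<close>

definition traverses :: "('a \<Rightarrow> 'a) \<Rightarrow> 'a set \<Rightarrow> bool" where
  "traverses \<pi> e \<longleftrightarrow> (\<exists>v\<in>e. \<pi> v \<in> e - {v})"

definition exchanges :: "('a \<Rightarrow> 'a) \<Rightarrow> 'a set \<Rightarrow> bool" where
  "exchanges \<pi> e \<longleftrightarrow> (\<forall>v\<in>e. \<pi> v \<in> e - {v})"

text \<open>The count is 0, 1 or 2: the first indicator detects at least one end sent to the other,
  the second detects both.\<close>

lemma card_moved_on_edge:
  assumes "card e = 2"
  shows "card {v \<in> e. \<pi> v \<in> e - {v}} = of_bool (traverses \<pi> e) + of_bool (exchanges \<pi> e)"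
proof -
  obtain a b where e: "e = {a, b}" "a \<noteq> b"
    using assms by (auto simp: card_2_iff)
  have "{v \<in> e. \<pi> v \<in> e - {v}} = (if \<pi> a = b then {a} else {}) \<union> (if \<pi> b = a then {b} else {})"
    using e by auto
  then show ?thesis
    using e by (auto simp: traverses_def exchanges_def)
qed

text \<open>A fixed vertex contributes a factor x, a vertex moved along an edge a factor -1, and a
  vertex moved to a non-neighbour the factor 0.\<close>

lemma perm_term_eq:
  assumes "finite V"
  shows "perm_term V E \<pi> =
    (if \<forall>v\<in>V. \<pi> v \<noteq> v \<longrightarrow> {v, \<pi> v} \<in> E
     then monom ((- 1) ^ card {v \<in> V. \<pi> v \<noteq> v}) (card {v \<in> V. \<pi> v = v}) else 0)"
proof (cases "\<forall>v\<in>V. \<pi> v \<noteq> v \<longrightarrow> {v, \<pi> v} \<in> E")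
  case True
  have split: "V = {v \<in> V. \<pi> v \<noteq> v} \<union> {v \<in> V. \<pi> v = v}"
    by auto
  have "perm_term V E \<pi> = (\<Prod>v\<in>{v \<in> V. \<pi> v \<noteq> v}. char_entry E v (\<pi> v)) *
      (\<Prod>v\<in>{v \<in> V. \<pi> v = v}. char_entry E v (\<pi> v))"
    unfolding perm_term_def using assms by (subst split, subst prod.union_disjoint) auto
  also have "(\<Prod>v\<in>{v \<in> V. \<pi> v \<noteq> v}. char_entry E v (\<pi> v)) =
      (\<Prod>v\<in>{v \<in> V. \<pi> v \<noteq> v}. [:- 1:])"
    using True by (intro prod.cong) (auto simp: char_entry_def one_pCons)
  also have "(\<Prod>v\<in>{v \<in> V. \<pi> v = v}. char_entry E v (\<pi> v)) =
      (\<Prod>v\<in>{v \<in> V. \<pi> v = v}. [:0, 1:])"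
    by (intro prod.cong) (auto simp: char_entry_def)
  finally show ?thesis
    using True by (simp add: monom_altdef poly_const_pow)
next
  case False
  then obtain v where "v \<in> V" "\<pi> v \<noteq> v" "{v, \<pi> v} \<notin> E"
    by auto
  then have "perm_term V E \<pi> = 0"
    unfolding perm_term_def using assms
    by (intro prod_zero) (auto simp: char_entry_def intro!: bexI[of _ v])
  then show ?thesis
    using False by simp
qed

section \<open>The identity for a single permutation\<close>

lemma x_pderiv_monom:
  fixes c :: "'a :: idom"
  shows "[:0, 1:] * pderiv (monom c n) = Polynomial.smult (of_nat n) (monom c n)"
  by (cases n) (simp_all add: pderiv_monom smult_monom flip: monom_Suc)

text \<open>Monomials are eigenvectors of x d/dx with their degree as eigenvalue, and the degree
  here is the number of fixed points.\<close>

lemma x_pderiv_perm_term: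
  assumes "finite V"
  shows "[:0, 1:] * pderiv (perm_term V E \<pi>) =
    Polynomial.smult (real (card {v \<in> V. \<pi> v = v})) (perm_term V E \<pi>)"
  unfolding perm_term_eq[OF assms] by (auto simp: x_pderiv_monom simp del: mult_pCons_left)

text \<open>Deleting \<open>e\<close> affects only factors of moved vertices \<open>v\<close> with
  \<open>{v, \<pi> v} = e\<close>; one such factor becomes 0 and kills the product.\<close>

lemma perm_term_delete_edge:
  assumes "finite V" "e \<in> E" "e \<subseteq> V" "card e = 2"
  shows "perm_term V (E - {e}) \<pi> = (if traverses \<pi> e then 0 else perm_term V E \<pi>)"
proof -
  have "traverses \<pi> e \<longleftrightarrow> (\<exists>v\<in>V. \<pi> v \<noteq> v \<and> {v, \<pi> v} = e)"
  proof -
    obtain a b where "e = {a, b}" "a \<noteq> b"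
      using assms by (auto simp: card_2_iff)
    then show ?thesis
      using assms(3) by (auto simp: traverses_def doubleton_eq_iff)
  qed
  then show ?thesis
    unfolding perm_term_eq[OF assms(1)] by auto
qed

text \<open>Each moved vertex \<open>v\<close> lies over exactly one edge
  \<open>{v, \<pi> v}\<close>. The fibre over \<open>e\<close> consists of the ends that are sent to
  the other end, so summing the fibre sizes gives the count.\<close>

lemma card_moved:
  assumes "finite V" "finite E" "\<And>e. e \<in> E \<Longrightarrow> e \<subseteq> V \<and> card e = 2"
    and "\<And>v. v \<in> V \<Longrightarrow> \<pi> v \<noteq> v \<Longrightarrow> {v, \<pi> v} \<in> E"
  shows "card {v \<in> V. \<pi> v \<noteq> v} = (\<Sum>e\<in>E. of_bool (traverses \<pi> e) + of_bool (exchanges \<pi> e))"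
proof -
  have "card {v \<in> V. \<pi> v \<noteq> v} =
      (\<Sum>e\<in>E. card {v \<in> {v \<in> V. \<pi> v \<noteq> v}. {v, \<pi> v} = e})"
    unfolding card_eq_sum using assms by (intro sum.group[symmetric]) auto
  also have "\<dots> = (\<Sum>e\<in>E. card {v \<in> e. \<pi> v \<in> e - {v}})"
  proof (intro sum.cong refl arg_cong[where f = card])
    fix e assume "e \<in> E"
    then have "e \<subseteq> V" "card e = 2"
      using assms(3) by auto
    then show "{v \<in> {v \<in> V. \<pi> v \<noteq> v}. {v, \<pi> v} = e} = {v \<in> e. \<pi> v \<in> e - {v}}"
      by (auto simp: card_2_iff)
  qed
  also have "\<dots> = (\<Sum>e\<in>E. of_bool (traverses \<pi> e) + of_bool (exchanges \<pi> e))"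
    using assms(3) by (intro sum.cong refl card_moved_on_edge) auto
  finally show ?thesis .
qed

lemma perm_term_identity:
  assumes "finite V" "finite E" "\<And>e. e \<in> E \<Longrightarrow> e \<subseteq> V \<and> card e = 2"
  shows "Polynomial.smult (real (card E) - real (card V)) (perm_term V E \<pi>) +
      [:0, 1:] * pderiv (perm_term V E \<pi>) =
    (\<Sum>e\<in>E. perm_term V (E - {e}) \<pi> - (if exchanges \<pi> e then perm_term V E \<pi> else 0))"
proof (cases "\<forall>v\<in>V. \<pi> v \<noteq> v \<longrightarrow> {v, \<pi> v} \<in> E")
  case True
  let ?T = "perm_term V E \<pi>"
  have "card V = card ({v \<in> V. \<pi> v \<noteq> v} \<union> {v \<in> V. \<pi> v = v})"
    by (rule arg_cong[where f = card]) auto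
  also have "\<dots> = card {v \<in> V. \<pi> v \<noteq> v} + card {v \<in> V. \<pi> v = v}"
    using assms(1) by (intro card_Un_disjoint) auto
  finally have V: "card V = card {v \<in> V. \<pi> v \<noteq> v} + card {v \<in> V. \<pi> v = v}" .
  have moved: "card {v \<in> V. \<pi> v \<noteq> v} =
      (\<Sum>e\<in>E. of_bool (traverses \<pi> e) + of_bool (exchanges \<pi> e))"
    using assms True by (intro card_moved) auto
  \<comment> \<open>The fixed points counted by the derivative cancel against those in
    \<open>card V\<close>.\<close>
  have "Polynomial.smult (real (card E) - real (card V)) ?T + [:0, 1:] * pderiv ?T =
      Polynomial.smult (real (card E) - real (card {v \<in> V. \<pi> v \<noteq> v})) ?T"
    unfolding x_pderiv_perm_term[OF assms(1)] V by (simp flip: smult_add_left)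
  also have "real (card E) - real (card {v \<in> V. \<pi> v \<noteq> v}) =
      (\<Sum>e\<in>E. 1 - of_bool (traverses \<pi> e) - of_bool (exchanges \<pi> e))"
    unfolding moved by (simp add: sum_subtractf sum.distrib)
  also have "Polynomial.smult \<dots> ?T =
      (\<Sum>e\<in>E. Polynomial.smult (1 - of_bool (traverses \<pi> e) - of_bool (exchanges \<pi> e)) ?T)"
    by (rule smult_sum)
  \<comment> \<open>The coefficient \<open>1 - of_bool (traverses \<pi> e)\<close> is exactly the
    effect of deleting \<open>e\<close>.\<close>
  also have "\<dots> = (\<Sum>e\<in>E. perm_term V (E - {e}) \<pi> - (if exchanges \<pi> e then ?T else 0))"
    using assms by (intro sum.cong) (auto simp: perm_term_delete_edge)
  finally show ?thesis .
next
  case False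
  \<comment> \<open>Removing edges cannot repair a missing adjacency, so both sides vanish.\<close>
  then have "perm_term V F \<pi> = 0" if "F \<subseteq> E" for F
    unfolding perm_term_eq[OF assms(1)] using that by auto
  then have "perm_term V E \<pi> = 0" "\<And>e. perm_term V (E - {e}) \<pi> = 0"
    by auto
  then show ?thesis
    by (simp cong: if_cong)
qed

section \<open>Permutations exchanging the ends of an edge\<close>

lemma perm_term_transpose:
  assumes "finite V" "a \<in> V" "b \<in> V" "a \<noteq> b" "{a, b} \<in> E" "\<pi> permutes V - {a, b}"
  shows "perm_term V E (\<pi> \<circ> transpose a b) =
    perm_term (V - {a, b}) {e \<in> E. e \<inter> {a, b} = {}} \<pi>"
proof -
  have fix_ab: "\<pi> a = a" "\<pi> b = b"
    using assms(6) by (auto intro: permutes_not_in)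
  have img: "\<pi> v \<in> V - {a, b}" if "v \<in> V - {a, b}" for v
    using assms(6) that by (simp add: permutes_in_image del: Diff_iff)
  have split: "V = {a, b} \<union> (V - {a, b})"
    using assms by auto
  have "perm_term V E (\<pi> \<circ> transpose a b) =
      (\<Prod>v\<in>{a, b}. char_entry E v (\<pi> (transpose a b v))) *
      (\<Prod>v\<in>V - {a, b}. char_entry E v (\<pi> (transpose a b v)))"
    unfolding perm_term_def comp_def using assms(1)
    by (subst split, subst prod.union_disjoint) auto
  \<comment> \<open>The composite exchanges \<open>a\<close> and \<open>b\<close>, and the two
    factors -1 cancel.\<close>
  also have "(\<Prod>v\<in>{a, b}. char_entry E v (\<pi> (transpose a b v))) = 1"
    using assms(4,5) by (simp add: fix_ab char_entry_def insert_commute)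
  \<comment> \<open>Since \<open>\<pi>\<close> maps \<open>V - {a, b}\<close> to itself,
    \<open>{v, \<pi> v}\<close> never meets \<open>{a, b}\<close>, and dropping the edges at
    \<open>a\<close> and \<open>b\<close> changes no factor.\<close>
  also have "(\<Prod>v\<in>V - {a, b}. char_entry E v (\<pi> (transpose a b v))) =
      perm_term (V - {a, b}) {e \<in> E. e \<inter> {a, b} = {}} \<pi>"
    unfolding perm_term_def
  proof (rule prod.cong[OF refl])
    fix v assume "v \<in> V - {a, b}"
    then show "char_entry E v (\<pi> (transpose a b v)) =
        char_entry {e \<in> E. e \<inter> {a, b} = {}} v (\<pi> v)"
      using img[of v] by (auto simp: char_entry_def)
  qed
  finally show ?thesis
    by (simp add: comp_def)
qed

text \<open>Composition with the transposition of the ends of \<open>e\<close> matches the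
  permutations exchanging them with the permutations of \<open>V - e\<close>, at the cost of a
  factor \<open>\<delta>\<close>. The latter are functions fixing everything outside
  \<open>V - e\<close>, so the same \<open>w\<close> weighs both.\<close>

lemma sum_exchanges:
  assumes "finite V" "e \<in> E" "e \<subseteq> V" "card e = 2"
    and w: "\<And>\<pi> a b. \<pi> permutes V \<Longrightarrow> a \<noteq> b \<Longrightarrow> w (\<pi> \<circ> transpose a b) = \<delta> * w \<pi>"
  shows "(\<Sum>\<pi> | \<pi> permutes V.
      Polynomial.smult (w \<pi>) (if exchanges \<pi> e then perm_term V E \<pi> else 0)) =
    Polynomial.smult \<delta> (\<Sum>\<pi> | \<pi> permutes V - e.
      Polynomial.smult (w \<pi>) (perm_term (V - e) {e' \<in> E. e' \<inter> e = {}} \<pi>))"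
proof -
  obtain a b where e: "e = {a, b}" "a \<noteq> b"
    using assms(4) by (auto simp: card_2_iff)
  have ab: "a \<in> V" "b \<in> V"
    using e assms(3) by auto
  have tr: "transpose a b permutes V"
    using ab by (rule permutes_swap_id)
  have exch: "exchanges \<pi> e \<longleftrightarrow> \<pi> a = b \<and> \<pi> b = a" for \<pi>
    using e by (auto simp: exchanges_def)
  have "(\<Sum>\<pi> | \<pi> permutes V.
      Polynomial.smult (w \<pi>) (if exchanges \<pi> e then perm_term V E \<pi> else 0)) =
    (\<Sum>\<pi> | \<pi> permutes V \<and> exchanges \<pi> e. Polynomial.smult (w \<pi>) (perm_term V E \<pi>))"
    using finite_permutations[OF assms(1)] by (intro sum.mono_neutral_cong_right) auto
  \<comment> \<open>The transposition is an involution, so the same map serves in both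
    directions.\<close>
  also have "\<dots> = (\<Sum>\<pi> | \<pi> permutes V - e.
      Polynomial.smult (\<delta> * w \<pi>) (perm_term (V - e) {e' \<in> E. e' \<inter> e = {}} \<pi>))"
  proof (rule sum.reindex_bij_witness[symmetric,
        where i = "\<lambda>\<pi>. \<pi> \<circ> transpose a b" and j = "\<lambda>\<pi>. \<pi> \<circ> transpose a b"])
    fix \<pi> assume "\<pi> \<in> {\<pi>. \<pi> permutes V \<and> exchanges \<pi> e}"
    then have \<pi>: "\<pi> permutes V" "\<pi> a = b" "\<pi> b = a"
      by (auto simp: exch)
    show "\<pi> \<circ> transpose a b \<circ> transpose a b = \<pi>"
      by (simp add: fun_eq_iff)
    have "\<pi> \<circ> transpose a b permutes V"
      by (intro permutes_compose tr \<pi>)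
    moreover have "(\<pi> \<circ> transpose a b) x = x" if "x \<in> V - (V - e)" for x
      using that e(1) \<pi>(2,3) by auto
    ultimately show "\<pi> \<circ> transpose a b \<in> {\<pi>. \<pi> permutes V - e}"
      by (auto intro: permutes_superset)
  next
    fix \<pi> assume "\<pi> \<in> {\<pi>. \<pi> permutes V - e}"
    then have \<pi>: "\<pi> permutes V - e"
      by simp
    then have \<pi>V: "\<pi> permutes V"
      by (rule permutes_subset) auto
    show "\<pi> \<circ> transpose a b \<circ> transpose a b = \<pi>"
      by (simp add: fun_eq_iff)
    have "\<pi> a = a" "\<pi> b = b"
      using \<pi> e by (auto intro: permutes_not_in)
    then show "\<pi> \<circ> transpose a b \<in> {\<pi>. \<pi> permutes V \<and> exchanges \<pi> e}"
      using permutes_compose[OF tr \<pi>V] by (simp add: exch)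
    show "Polynomial.smult (w (\<pi> \<circ> transpose a b)) (perm_term V E (\<pi> \<circ> transpose a b)) =
        Polynomial.smult (\<delta> * w \<pi>) (perm_term (V - e) {e' \<in> E. e' \<inter> e = {}} \<pi>)"
      using perm_term_transpose[OF assms(1) ab e(2), of E \<pi>] assms(2) \<pi> w[OF \<pi>V e(2)] e(1)
      by simp
  qed
  also have "\<dots> = Polynomial.smult \<delta> (\<Sum>\<pi> | \<pi> permutes V - e.
      Polynomial.smult (w \<pi>) (perm_term (V - e) {e' \<in> E. e' \<inter> e = {}} \<pi>))"
    by (simp add: smult_sum2)
  finally show ?thesis .
qed

text \<open>The identity for a single permutation is weighted by \<open>w\<close> and summed over
  all permutations. After swapping the sums, the terms of each edge are the sums for the two smaller
  graphs.\<close>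

lemma immanant_sum_identity:
  assumes "simple_graph G"
    and w: "\<And>\<pi> a b. \<pi> permutes verts G \<Longrightarrow> a \<noteq> b \<Longrightarrow> w (\<pi> \<circ> transpose a b) = \<delta> * w \<pi>"
  shows "Polynomial.smult (real (card (edges G)) - real (card (verts G))) (immanant_sum w G)
      + [:0, 1:] * pderiv (immanant_sum w G) =
    (\<Sum>e\<in>edges G. immanant_sum w (delete_edge G e)
      - Polynomial.smult \<delta> (immanant_sum w (delete_verts G e)))"
proof -
  define V E where "V = verts G" and "E = edges G"
  have V: "finite V" and E: "\<And>e. e \<in> E \<Longrightarrow> e \<subseteq> V \<and> card e = 2"
    using assms(1) by (auto simp: simple_graph_def V_def E_def)
  have "finite E"
    using V E by (intro finite_subset[of E "Pow V"]) auto
  let ?P = "{\<pi>. \<pi> permutes V}" and ?c = "real (card E) - real (card V)"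
  have "Polynomial.smult ?c (immanant_sum w G) + [:0, 1:] * pderiv (immanant_sum w G) =
      (\<Sum>\<pi>\<in>?P. Polynomial.smult (w \<pi>)
        (Polynomial.smult ?c (perm_term V E \<pi>) + [:0, 1:] * pderiv (perm_term V E \<pi>)))"
    unfolding immanant_sum_def V_def[symmetric] E_def[symmetric]
    by (simp add: smult_sum2 pderiv_sum pderiv_smult sum_distrib_left sum.distrib
        smult_add_right mult.commute del: mult_pCons_left mult_pCons_right)
  also have "\<dots> = (\<Sum>\<pi>\<in>?P. \<Sum>e\<in>E. Polynomial.smult (w \<pi>) (perm_term V (E - {e}) \<pi>)
      - Polynomial.smult (w \<pi>) (if exchanges \<pi> e then perm_term V E \<pi> else 0))"
    by (simp only: perm_term_identity[OF V \<open>finite E\<close> E] smult_sum2 smult_diff_right)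
  also have "\<dots> = (\<Sum>e\<in>E. (\<Sum>\<pi>\<in>?P. Polynomial.smult (w \<pi>) (perm_term V (E - {e}) \<pi>))
      - (\<Sum>\<pi>\<in>?P. Polynomial.smult (w \<pi>) (if exchanges \<pi> e then perm_term V E \<pi> else 0)))"
    unfolding sum_subtractf[symmetric] by (rule sum.swap)
  also have "\<dots> = (\<Sum>e\<in>E. immanant_sum w (delete_edge G e)
      - Polynomial.smult \<delta> (immanant_sum w (delete_verts G e)))"
  proof (rule sum.cong[OF refl])
    fix e assume "e \<in> E"
    then show "(\<Sum>\<pi>\<in>?P. Polynomial.smult (w \<pi>) (perm_term V (E - {e}) \<pi>))
        - (\<Sum>\<pi>\<in>?P. Polynomial.smult (w \<pi>) (if exchanges \<pi> e then perm_term V E \<pi> else 0)) =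
      immanant_sum w (delete_edge G e) - Polynomial.smult \<delta> (immanant_sum w (delete_verts G e))"
      using sum_exchanges[OF V, of e E w \<delta>] E[of e] w
      by (simp add: immanant_sum_def delete_edge_def delete_verts_def V_def E_def)
  qed
  finally show ?thesis
    by (simp add: V_def E_def)
qed

section \<open>From vertices back to matrix indices\<close>

lemma sum_permutations_char_poly_matrix:
  fixes vs :: "'a list"
  assumes "distinct vs" and E: "\<forall>e\<in>E. card e = 2"
    and w: "\<And>p. p permutes {0..<length vs} \<Longrightarrow>
      w (map_permutation {0..<length vs} ((!) vs) p) = w' p"
  shows "(\<Sum>p | p permutes {0..<length vs}. Polynomial.smult (w' p)
      (\<Prod>k = 0..<length vs. char_poly_matrix (adj_matrix_of E vs) $$ (k, p k))) =
    (\<Sum>\<pi> | \<pi> permutes set vs. Polynomial.smult (w \<pi>) (perm_term (set vs) E \<pi>))"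
proof -
  let ?I = "{0..<length vs}" and ?f = "(!) vs"
  have bij: "bij_betw ?f ?I (set vs)"
    using assms(1) bij_betw_nth[of vs ?I "set vs"] by (simp add: lessThan_atLeast0)
  then have inj: "inj_on ?f ?I"
    by (rule bij_betw_imp_inj_on)
  note bij' = bij_betw_inv_into[OF bij]
  show ?thesis
  \<comment> \<open>Conjugation by the enumeration \<open>?f\<close> turns permutations of indices
    into permutations of vertices.\<close>
  proof (rule sum.reindex_bij_witness[where j = "map_permutation ?I ?f"
        and i = "map_permutation (set vs) (inv_into ?I ?f)"])
    fix p assume "p \<in> {p. p permutes ?I}"
    then have p: "p permutes ?I"
      by simp
    show "map_permutation (set vs) (inv_into ?I ?f) (map_permutation ?I ?f p) = p"
      using bij p by (rule map_permutation_compose_inv) (simp add: inj)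
    show "map_permutation ?I ?f p \<in> {\<pi>. \<pi> permutes set vs}"
      using map_permutation_permutes[OF bij p] by simp
    have "perm_term (set vs) E (map_permutation ?I ?f p) =
        (\<Prod>k = 0..<length vs. char_entry E (vs ! k) (map_permutation ?I ?f p (vs ! k)))"
      unfolding perm_term_def by (rule prod.reindex_bij_betw[OF bij, symmetric])
    also have "\<dots> = (\<Prod>k = 0..<length vs. char_poly_matrix (adj_matrix_of E vs) $$ (k, p k))"
    proof (rule prod.cong[OF refl])
      fix k assume k: "k \<in> {0..<length vs}"
      then have pk: "p k < length vs"
        using permutes_in_image[OF p, of k] by simp
      \<comment> \<open>A diagonal entry of the adjacency matrix tests the singleton
        \<open>{v, v}\<close>; as there are no loops, the diagonal of xI - A is x.\<close>
      have "{vs ! k} \<notin> E"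
        using E by force
      then show "char_entry E (vs ! k) (map_permutation ?I ?f p (vs ! k)) =
          char_poly_matrix (adj_matrix_of E vs) $$ (k, p k)"
        unfolding map_permutation_apply[OF inj k] using k pk assms(1)
        by (auto simp: char_entry_def char_poly_matrix_def adj_matrix_of_def
            nth_eq_iff_index_eq one_pCons)
    qed
    finally show "Polynomial.smult (w (map_permutation ?I ?f p))
        (perm_term (set vs) E (map_permutation ?I ?f p)) =
      Polynomial.smult (w' p)
        (\<Prod>k = 0..<length vs. char_poly_matrix (adj_matrix_of E vs) $$ (k, p k))"
      by (simp add: w[OF p])
  next
    fix \<pi> assume "\<pi> \<in> {\<pi>. \<pi> permutes set vs}"
    then have \<pi>: "\<pi> permutes set vs"
      by simp
    show "map_permutation ?I ?f (map_permutation (set vs) (inv_into ?I ?f) \<pi>) = \<pi>"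
      using bij' \<pi> by (rule map_permutation_compose_inv) (rule bij_betw_inv_into_right[OF bij])
    show "map_permutation (set vs) (inv_into ?I ?f) \<pi> \<in> {p. p permutes ?I}"
      using map_permutation_permutes[OF bij' \<pi>] by simp
  qed
qed

text \<open>This is the Leibniz expansion; relabelling indices as vertices preserves the
  sign.\<close>

lemma sigma1_eq_immanant_sum:
  assumes "simple_graph G"
  shows "sigma1 G = immanant_sum (\<lambda>\<pi>. of_int (sign \<pi>)) G"
proof -
  let ?vs = "vertex_list G" and ?w = "\<lambda>\<pi>. real_of_int (sign \<pi>)"
  have fin: "finite (verts G)" and E: "\<forall>e\<in>edges G. card e = 2"
    using assms by (auto simp: simple_graph_def)
  note vs = vertex_list[OF fin]
  have inj: "inj_on ((!) ?vs) {0..<length ?vs}"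
    using vs(1) by (simp add: inj_on_nth)
  have "sigma1 G = (\<Sum>p | p permutes {0..<length ?vs}. Polynomial.smult (?w p)
      (\<Prod>k = 0..<length ?vs. char_poly_matrix (adj_matrix_of (edges G) ?vs) $$ (k, p k)))"
    unfolding sigma1_def adj_matrix_def
      det_def'[OF char_poly_matrix_closed[OF adj_matrix_of_carrier]]
    by (intro sum.cong) (auto simp: sign_def)
  also have "\<dots> = immanant_sum ?w G"
    unfolding immanant_sum_def vs(2)[symmetric]
    using vs(1) E inj
    by (intro sum_permutations_char_poly_matrix) (simp_all add: sign_map_permutation)
  finally show ?thesis .
qed

lemma sigma4_eq_immanant_sum:
  assumes "simple_graph G"
  shows "sigma4 G = immanant_sum (\<lambda>_. 1) G"
proof -
  let ?vs = "vertex_list G"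
  have fin: "finite (verts G)" and E: "\<forall>e\<in>edges G. card e = 2"
    using assms by (auto simp: simple_graph_def)
  note vs = vertex_list[OF fin]
  have "sigma4 G = (\<Sum>p | p permutes {0..<length ?vs}. Polynomial.smult 1
      (\<Prod>k = 0..<length ?vs. char_poly_matrix (adj_matrix_of (edges G) ?vs) $$ (k, p k)))"
    using char_poly_matrix_closed[OF adj_matrix_of_carrier[of "edges G" ?vs]]
    by (simp add: sigma4_def adj_matrix_def per_def)
  also have "\<dots> = immanant_sum (\<lambda>_. 1) G"
    unfolding immanant_sum_def vs(2)[symmetric]
    using vs(1) E by (intro sum_permutations_char_poly_matrix) simp_all
  finally show ?thesis .
qed

lemma sign_comp_transpose:
  assumes "finite V" "\<pi> permutes V" "a \<noteq> b"
  shows "sign (\<pi> \<circ> transpose a b) = - sign \<pi>"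
  using assms
  by (simp add: sign_compose permutes_imp_permutation permutation_swap_id sign_swap_id)

theorem theorem3p3:
  fixes G :: "'a ugraph"
  assumes "simple_graph G"
  shows "(Polynomial.smult (real (card (edges G)) - real (card (verts G))) (sigma1 G)
           + [:0, 1:] * pderiv (sigma1 G)
         = (\<Sum>e \<in> edges G. sigma1 (delete_edge G e) + sigma1 (delete_verts G e)))
    \<and> (Polynomial.smult (real (card (edges G)) - real (card (verts G))) (sigma4 G)
           + [:0, 1:] * pderiv (sigma4 G)
         = (\<Sum>e \<in> edges G. sigma4 (delete_edge G e) - sigma4 (delete_verts G e)))"
proof -
  have fin: "finite (verts G)"
    using assms by (simp add: simple_graph_def)
  have sub: "simple_graph (delete_edge G e)" "simple_graph (delete_verts G e)" for e
    using assms by (auto simp: simple_graph_def delete_edge_def delete_verts_def)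
  have w1: "real_of_int (sign (\<pi> \<circ> transpose a b)) = - 1 * real_of_int (sign \<pi>)"
    if "\<pi> permutes verts G" "a \<noteq> b" for \<pi> and a b :: 'a
    using sign_comp_transpose[OF fin that] by simp
  \<comment> \<open>A transposition flips the sign, so \<open>\<delta>\<close> is -1 for the
    determinant and the difference becomes a sum; for the permanent \<open>\<delta>\<close> is
    1.\<close>
  show ?thesis
    using immanant_sum_identity[OF assms w1] immanant_sum_identity[OF assms, of "\<lambda>_. 1" 1]
    by (simp add: sigma1_eq_immanant_sum sigma4_eq_immanant_sum assms sub
        del: mult_pCons_left)
qed

end
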